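(* Let $\alpha_1,\beta_1,\beta_2>0$ and $B_1\ge0$, and suppose $\alpha_1\ge\beta_2$. For $b>0$ let $$\tilde\Psi(b;z)=\Gamma(b)\sum_{k=0}^\infty\frac{\Gamma(\alpha_1+k)}{\Gamma(b+kB_1)\,\Gamma(\beta_2+k)}\frac{z^k}{k!}.$$ Then for all $z\in(0,\infty)$ $$\Bigg[\Bigg(\frac{\Gamma(\alpha_1)}{\Gamma(\beta_2)}\Bigg)^{\frac{B_1}{\beta_1}}\tilde\Psi(\beta_1;z)\Bigg]^{\frac{\Gamma(\beta_1+B_1)}{\Gamma(\beta_1)}}\le\Big[\tilde\Psi(\beta_1+1;z)\Big]^{\frac{\Gamma(\beta_1+B_1+1)}{\Gamma(\beta_1+1)}}.$$
   Context: In the paper's notation $\tilde\Psi(b;z)={}_1\tilde\Psi_2\Big[\begin{matrix}(\alpha_1,1)\\ (b,B_1),(\beta_2,1)\end{matrix}\Big|z\Big]$, where ${}_p\tilde\Psi_q$ is the Fox-Wright function ${}_p\Psi_q\Big[\begin{matrix}(\alpha_1,A_1),\dots,(\alpha_p,A_p)\\ (\beta_1,B_1),\dots,(\beta_q,B_q)\end{matrix}\Big|z\Big]=\sum_{k=0}^\infty\frac{\prod_{l=1}^p\Gamma(\alpha_l+kA_l)}{\prod_{l=1}^q\Gamma(\beta_l+kB_l)}\frac{z^k}{k!}$ multiplied by $\Gamma$ of its first lower parameter. *)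

theory Defs
  imports "HOL-Analysis.Analysis"
begin

text \<open>
  Real Fox--Wright functions. The parameter pairs \<open>(\<alpha>\<^sub>l, A\<^sub>l)\<close> and \<open>(\<beta>\<^sub>l, B\<^sub>l)\<close> are given as lists,
  with \<open>p\<close> and \<open>q\<close> their lengths. The value is meaningful only where the series converges and no
  Gamma factor is evaluated at a pole.
\<close>

definition fox_wright :: "(real \<times> real) list \<Rightarrow> (real \<times> real) list \<Rightarrow> real \<Rightarrow> real" where
  "fox_wright as bs z =
     (\<Sum>k. (\<Prod>(a, A)\<leftarrow>as. Gamma (a + real k * A)) / (\<Prod>(b, B)\<leftarrow>bs. Gamma (b + real k * B))
            * (z ^ k / fact k))"

text \<open>The normalisation multiplies by Gamma of the first lower parameter only.\<close>

definition fox_wright_tilde :: "(real \<times> real) list \<Rightarrow> (real \<times> real) list \<Rightarrow> real \<Rightarrow> real" where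
  "fox_wright_tilde as bs z = Gamma (fst (hd bs)) * fox_wright as bs z"

definition Psi_tilde :: "real \<Rightarrow> real \<Rightarrow> real \<Rightarrow> real \<Rightarrow> real \<Rightarrow> real" where
  "Psi_tilde \<alpha>\<^sub>1 \<beta>\<^sub>2 B\<^sub>1 b z = fox_wright_tilde [(\<alpha>\<^sub>1, 1)] [(b, B\<^sub>1), (\<beta>\<^sub>2, 1)] z"

lemma Psi_tilde_eq:
  "Psi_tilde \<alpha>\<^sub>1 \<beta>\<^sub>2 B\<^sub>1 b z =
     Gamma b * (\<Sum>k. Gamma (\<alpha>\<^sub>1 + real k) / (Gamma (b + real k * B\<^sub>1) * Gamma (\<beta>\<^sub>2 + real k))
                       * (z ^ k / fact k))"
  by (simp add: Psi_tilde_def fox_wright_tilde_def fox_wright_def)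

end

theory Submission
  imports Defs
begin

text \<open>
  Put \<open>q = B\<^sub>1 / \<beta>\<^sub>1\<close>. As \<open>\<Gamma>(x + 1) = x \<Gamma>(x)\<close>, the outer exponent on the right is \<open>1 + q\<close> times the
  one on the left, so with \<open>c\<^sub>0 = \<Gamma>(\<alpha>\<^sub>1) / \<Gamma>(\<beta>\<^sub>2)\<close> the claim is
  \<open>c\<^sub>0\<^sup>q \<Psi>(\<beta>\<^sub>1; z) \<le> \<Psi>(\<beta>\<^sub>1 + 1; z)\<^sup>1\<^sup>+\<^sup>q\<close>.

  Write \<open>F(z) = \<Psi>(\<beta>\<^sub>1 + 1; z) = \<Sum>\<^sub>k c\<^sub>k z\<^sup>k / k!\<close>, so that \<open>F(0) = c\<^sub>0\<close>. The same functional equation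
  shows that the coefficients of \<open>\<Psi>(\<beta>\<^sub>1; z)\<close> are \<open>(1 + q k) c\<^sub>k\<close>, that is,
  \<open>\<Psi>(\<beta>\<^sub>1; z) = F(z) + q z F'(z)\<close>. The claim becomes \<open>1 + q z F'(z) / F(z) \<le> (F(z) / c\<^sub>0)\<^sup>q\<close>, and since
  \<open>1 + x \<le> e\<^sup>x\<close> it is enough that \<open>z F'(z) / F(z) \<le> ln F(z) - ln F(0)\<close>. This is the tangent
  inequality for a concave function, here \<open>ln F\<close> on \<open>[0, \<infinity>)\<close>
  (lemma \<open>exp_gen_deriv_le_ln\<close>).

  Concavity of \<open>ln F\<close> means that \<open>F' / F\<close> decreases. Both \<open>F\<close> and \<open>F'\<close> are exponential generating
  functions, of \<open>c\<^sub>k\<close> and of \<open>c\<^sub>k\<^sub>+\<^sub>1\<close>, and a quotient of two power series decreases when the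
  quotient of their coefficients does (lemma \<open>exp_gen_ratio_antimono\<close>). So it remains to see
  that \<open>c\<^sub>k\<close> is log-concave (lemma \<open>Fox_Wright_coeff_log_concave\<close>): \<open>c\<^sub>k\<^sub>+\<^sub>1 / c\<^sub>k\<close> is the product of
  \<open>(\<alpha>\<^sub>1 + k) / (\<beta>\<^sub>2 + k)\<close>, decreasing because \<open>\<alpha>\<^sub>1 \<ge> \<beta>\<^sub>2\<close>, and of
  \<open>\<Gamma>(\<beta>\<^sub>1 + 1 + k B\<^sub>1) / \<Gamma>(\<beta>\<^sub>1 + 1 + (k + 1) B\<^sub>1)\<close>, decreasing because \<open>\<Gamma>\<close> is log-convex.
\<close>

section \<open>Exponential generating functions of log-concave sequences\<close>

definition exp_gen :: "(nat \<Rightarrow> real) \<Rightarrow> real \<Rightarrow> real" where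
  "exp_gen c z = (\<Sum>k. c k * (z ^ k / fact k))"

definition log_concave_seq :: "(nat \<Rightarrow> real) \<Rightarrow> bool" where
  "log_concave_seq c \<longleftrightarrow> (\<forall>k. c k > 0 \<and> c (Suc (Suc k)) * c k \<le> c (Suc k) ^ 2)"

lemma log_concave_seq_pos: "log_concave_seq c \<Longrightarrow> c k > 0"
  by (simp add: log_concave_seq_def)

lemma log_concave_seq_ratio_antimono:
  assumes "log_concave_seq c" and "j \<le> k"
  shows "c (Suc k) / c k \<le> c (Suc j) / c j"
proof -
  have "decseq (\<lambda>k. c (Suc k) / c k)"
  proof (rule decseq_SucI)
    fix n
    show "c (Suc (Suc n)) / c (Suc n) \<le> c (Suc n) / c n"
      using assms(1) by (simp add: log_concave_seq_def divide_simps power2_eq_square)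
  qed
  then show ?thesis
    using assms(2) by (auto simp: decseq_def)
qed

lemma log_concave_seq_cross:
  assumes "log_concave_seq c" and "j \<le> k"
  shows "c (Suc k) * c j \<le> c (Suc j) * c k"
  using log_concave_seq_ratio_antimono[OF assms] log_concave_seq_pos[OF assms(1), of j]
    log_concave_seq_pos[OF assms(1), of k]
  by (simp add: divide_simps mult.commute)

lemma log_concave_seq_le_geometric:
  assumes "log_concave_seq c"
  shows "c k \<le> c 0 * (c 1 / c 0) ^ k"
proof (induction k)
  case 0
  then show ?case by simp
next
  case (Suc k)
  have "c (Suc k) \<le> c 1 / c 0 * c k"
    using log_concave_seq_ratio_antimono[OF assms, of 0 k] log_concave_seq_pos[OF assms, of k]
    by (simp add: pos_divide_le_eq)
  also have "\<dots> \<le> c 1 / c 0 * (c 0 * (c 1 / c 0) ^ k)"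
    using Suc log_concave_seq_pos[OF assms]
    by (intro mult_left_mono) (auto intro!: divide_nonneg_nonneg less_imp_le)
  finally show ?case by (simp add: mult_ac)
qed

lemma summable_exp_gen:
  assumes "log_concave_seq c"
  shows "summable (\<lambda>k. c k * (z ^ k / fact k))"
proof (rule summable_comparison_test)
  let ?r = "c 1 / c 0"
  have "summable (\<lambda>k. inverse (fact k) * (?r * \<bar>z\<bar>) ^ k)"
    by (rule summable_exp)
  then show "summable (\<lambda>k. c 0 * (inverse (fact k) * (?r * \<bar>z\<bar>) ^ k))"
    by (rule summable_mult)
  show "\<exists>N. \<forall>n\<ge>N. norm (c n * (z ^ n / fact n)) \<le> c 0 * (inverse (fact n) * (?r * \<bar>z\<bar>) ^ n)"
  proof (intro exI allI impI)
    fix n :: nat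
    have "c n * (\<bar>z\<bar> ^ n / fact n) \<le> c 0 * ?r ^ n * (\<bar>z\<bar> ^ n / fact n)"
      by (intro mult_right_mono log_concave_seq_le_geometric assms) auto
    then show "norm (c n * (z ^ n / fact n)) \<le> c 0 * (inverse (fact n) * (?r * \<bar>z\<bar>) ^ n)"
      using log_concave_seq_pos[OF assms, of n]
      by (simp add: abs_mult power_abs power_mult_distrib divide_inverse mult_ac)
  qed
qed

lemma log_concave_seq_shift:
  "log_concave_seq c \<Longrightarrow> log_concave_seq (\<lambda>k. c (Suc k))"
  by (simp add: log_concave_seq_def)

lemma exp_gen_0: "exp_gen c 0 = c 0"
proof -
  have "exp_gen c 0 = (\<Sum>k. (c k / fact k) * 0 ^ k)"
    by (simp add: exp_gen_def)
  then show ?thesis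
    by (subst (asm) powser_zero) simp
qed

lemma exp_gen_pos:
  assumes "log_concave_seq c" and "z \<ge> 0"
  shows "exp_gen c z > 0"
  unfolding exp_gen_def
proof (rule suminf_pos2[OF summable_exp_gen[OF assms(1)], of _ 0])
  show "0 \<le> c n * (z ^ n / fact n)" for n
    using log_concave_seq_pos[OF assms(1), of n] assms(2) by simp
  show "0 < c 0 * (z ^ 0 / fact 0)"
    using log_concave_seq_pos[OF assms(1)] by simp
qed

lemma has_real_derivative_exp_gen:
  assumes "log_concave_seq c"
  shows "(exp_gen c has_real_derivative exp_gen (\<lambda>k. c (Suc k)) z) (at z)"
proof -
  have eq: "exp_gen c = (\<lambda>x. \<Sum>k. (c k / fact k) * x ^ k)"
    by (simp add: exp_gen_def fun_eq_iff)
  have "diffs (\<lambda>k. c k / fact k) = (\<lambda>k. c (Suc k) / fact k)"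
    by (simp add: diffs_def fun_eq_iff divide_simps)
  moreover have "summable (\<lambda>k. (c k / fact k) * x ^ k)" for x
    using summable_exp_gen[OF assms, of x] by simp
  ultimately have "((\<lambda>x. \<Sum>k. (c k / fact k) * x ^ k) has_real_derivative
      (\<Sum>k. (c (Suc k) / fact k) * z ^ k)) (at z)"
    using termdiffs_strong_converges_everywhere[of "\<lambda>k. c k / fact k" z] by simp
  then show ?thesis
    unfolding eq by (simp add: exp_gen_def)
qed

text \<open>
  The Euler operator \<open>z d/dz\<close> multiplies the \<open>k\<close>-th term by \<open>k\<close>, since \<open>k / k! = 1 / (k - 1)!\<close>.
\<close>

lemma exp_gen_euler_operator:
  assumes "log_concave_seq c"
  shows "exp_gen (\<lambda>k. (1 + q * real k) * c k) z
       = exp_gen c z + q * (z * exp_gen (\<lambda>k. c (Suc k)) z)"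
proof -
  have F: "(\<lambda>k. c k * (z ^ k / fact k)) sums exp_gen c z"
    unfolding exp_gen_def by (intro summable_sums summable_exp_gen assms)
  have "(\<lambda>k. c (Suc k) * (z ^ k / fact k)) sums exp_gen (\<lambda>k. c (Suc k)) z"
    unfolding exp_gen_def by (intro summable_sums summable_exp_gen log_concave_seq_shift assms)
  then have "(\<lambda>k. z * (c (Suc k) * (z ^ k / fact k))) sums (z * exp_gen (\<lambda>k. c (Suc k)) z)"
    by (rule sums_mult)
  moreover have "(\<lambda>k. z * (c (Suc k) * (z ^ k / fact k)))
      = (\<lambda>k. real (Suc k) * c (Suc k) * (z ^ Suc k / fact (Suc k)))"
    by (rule ext) (simp add: divide_simps)
  ultimately have "(\<lambda>k. real (Suc k) * c (Suc k) * (z ^ Suc k / fact (Suc k)))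
      sums (z * exp_gen (\<lambda>k. c (Suc k)) z)"
    by simp
  then have G: "(\<lambda>k. real k * c k * (z ^ k / fact k)) sums (z * exp_gen (\<lambda>k. c (Suc k)) z)"
    by (subst (asm) sums_Suc_iff) simp
  have "(\<lambda>k. (1 + q * real k) * c k * (z ^ k / fact k))
      sums (exp_gen c z + q * (z * exp_gen (\<lambda>k. c (Suc k)) z))"
    using sums_add[OF F sums_mult[OF G, of q]] by (simp add: algebra_simps)
  then show ?thesis
    unfolding exp_gen_def by (simp add: sums_iff)
qed

text \<open>
  The logarithmic derivative \<open>F' / F\<close> decreases, in cross-multiplied form. In the difference of
  the two products the terms with indices \<open>(j, k)\<close> and \<open>(k, j)\<close> combine to
  \<open>(c\<^sub>j\<^sub>+\<^sub>1 c\<^sub>k - c\<^sub>k\<^sub>+\<^sub>1 c\<^sub>j) (z\<^sup>j x\<^sup>k - x\<^sup>j z\<^sup>k) / (j! k!)\<close>; for \<open>j \<le> k\<close> the first factor is nonnegative by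
  log-concavity and the second nonpositive by \<open>x \<le> z\<close>. Partial sums avoid rearranging a
  double series.
\<close>

lemma exp_gen_ratio_antimono:
  assumes c: "log_concave_seq c" and xz: "0 \<le> x" "x \<le> z"
  shows "exp_gen (\<lambda>k. c (Suc k)) z * exp_gen c x \<le> exp_gen (\<lambda>k. c (Suc k)) x * exp_gen c z"
proof -
  define P where "P d y n = (\<Sum>k<n. d k * (y ^ k / fact k))" for d :: "nat \<Rightarrow> real" and y n
  have lim: "P d y \<longlonglongrightarrow> exp_gen d y" if "log_concave_seq d" for d y
    using summable_LIMSEQ[OF summable_exp_gen[OF that]] unfolding P_def exp_gen_def .
  define t where "t j k = c (Suc j) * c k * (z ^ j * x ^ k - x ^ j * z ^ k) / (fact j * fact k)"
    for j k
  have t_sym: "t j k + t k j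
      = (c (Suc j) * c k - c (Suc k) * c j) * (z ^ j * x ^ k - x ^ j * z ^ k) / (fact j * fact k)"
    for j k
    unfolding t_def by (simp add: field_simps)
  have t_le: "t j k + t k j \<le> 0" if "j \<le> k" for j k
  proof -
    have "z ^ j * x ^ k \<le> x ^ j * z ^ k"
    proof -
      have "z ^ j * x ^ k = (z * x) ^ j * x ^ (k - j)"
        using that by (simp add: power_mult_distrib flip: power_add)
      also have "\<dots> \<le> (z * x) ^ j * z ^ (k - j)"
        using xz by (intro mult_left_mono power_mono) auto
      also have "\<dots> = x ^ j * z ^ k"
        using that by (simp add: power_mult_distrib flip: power_add)
      finally show ?thesis .
    qed
    then show ?thesis
      unfolding t_sym using log_concave_seq_cross[OF c that]
      by (intro divide_nonpos_pos mult_nonneg_nonpos) auto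
  qed
  have t_le': "t j k + t k j \<le> 0" for j k
    using t_le[of j k] t_le[of k j] by (cases "j \<le> k") (auto simp: add.commute)
  have "P (\<lambda>k. c (Suc k)) z n * P c x n \<le> P (\<lambda>k. c (Suc k)) x n * P c z n" for n
  proof -
    have "P (\<lambda>k. c (Suc k)) z n * P c x n - P (\<lambda>k. c (Suc k)) x n * P c z n
        = (\<Sum>j<n. \<Sum>k<n. t j k)" (is "?D = ?S")
      unfolding P_def t_def sum_product sum_subtractf[symmetric]
      by (intro sum.cong refl) (simp add: field_simps)
    moreover have "?S + ?S = (\<Sum>j<n. \<Sum>k<n. t j k) + (\<Sum>j<n. \<Sum>k<n. t k j)"
      by (subst (2) sum.swap) (rule refl)
    then have "?S + ?S = (\<Sum>j<n. \<Sum>k<n. t j k + t k j)"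
      by (simp add: sum.distrib)
    moreover have "\<dots> \<le> 0"
      by (intro sum_nonpos t_le')
    ultimately show ?thesis by linarith
  qed
  then show ?thesis
    by (rule LIMSEQ_le[OF tendsto_mult[OF lim lim] tendsto_mult[OF lim lim], rotated -1,
          OF exI[of _ 0], rule_format])
      (intro c log_concave_seq_shift)+
qed

text \<open>
  The tangent inequality at \<open>z\<close> for the concave function \<open>ln F\<close>, evaluated at \<open>0\<close>: by the mean
  value theorem \<open>ln F(z) - ln F(0)\<close> is \<open>z\<close> times an earlier, hence larger, value of \<open>F' / F\<close>.
\<close>

lemma exp_gen_deriv_le_ln:
  assumes c: "log_concave_seq c" and z: "z > 0"
  shows "z * (exp_gen (\<lambda>k. c (Suc k)) z / exp_gen c z) \<le> ln (exp_gen c z / c 0)"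
proof -
  let ?F = "exp_gen c" and ?F' = "exp_gen (\<lambda>k. c (Suc k))"
  have "((\<lambda>x. ln (?F x)) has_real_derivative ?F' x / ?F x) (at x)" if "0 \<le> x" for x
    using exp_gen_pos[OF c that]
    by (auto intro!: derivative_eq_intros has_real_derivative_exp_gen c)
  then obtain x where x: "0 < x" "x < z" "ln (?F z) - ln (?F 0) = (z - 0) * (?F' x / ?F x)"
    using MVT2[OF z, of "\<lambda>x. ln (?F x)" "\<lambda>x. ?F' x / ?F x"] by auto
  have "?F' z / ?F z \<le> ?F' x / ?F x"
    using exp_gen_ratio_antimono[OF c, of x z] exp_gen_pos[OF c, of x] exp_gen_pos[OF c, of z] x z
    by (simp add: divide_simps mult.commute)
  then have "z * (?F' z / ?F z) \<le> z * (?F' x / ?F x)"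
    using z by (intro mult_left_mono) auto
  also have "\<dots> = ln (?F z / c 0)"
    using x(3) exp_gen_pos[OF c, of z] z log_concave_seq_pos[OF c, of 0]
    by (simp add: exp_gen_0 ln_div)
  finally show ?thesis .
qed

lemma exp_gen_euler_operator_le_powr:
  assumes c: "log_concave_seq c" and q: "q \<ge> 0" and z: "z > 0"
  shows "c 0 powr q * exp_gen (\<lambda>k. (1 + q * real k) * c k) z \<le> exp_gen c z powr (1 + q)"
proof -
  define F F' where "F = exp_gen c z" and "F' = exp_gen (\<lambda>k. c (Suc k)) z"
  have F: "F > 0" and c0: "c 0 > 0"
    using exp_gen_pos[OF c, of z] z log_concave_seq_pos[OF c] by (auto simp: F_def)
  have "1 + q * (z * (F' / F)) \<le> 1 + q * ln (F / c 0)"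
    using exp_gen_deriv_le_ln[OF c z] q unfolding F_def F'_def
    by (intro add_left_mono mult_left_mono) auto
  also have "\<dots> \<le> exp (q * ln (F / c 0))"
    by (rule exp_ge_add_one_self)
  also have "\<dots> = (F / c 0) powr q"
    using F c0 by (simp add: powr_def)
  also have "\<dots> = F powr q / c 0 powr q"
    using F c0 by (simp add: powr_divide)
  finally have "(c 0 powr q * F) * (1 + q * (z * (F' / F)))
      \<le> (c 0 powr q * F) * (F powr q / c 0 powr q)"
    using F by (intro mult_left_mono) auto
  moreover have "(c 0 powr q * F) * (1 + q * (z * (F' / F))) = c 0 powr q * (F + q * (z * F'))"
    using F by (simp add: field_simps)
  moreover have "(c 0 powr q * F) * (F powr q / c 0 powr q) = F powr (1 + q)"
    using F c0 by (simp add: powr_add)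
  ultimately have "c 0 powr q * (F + q * (z * F')) \<le> F powr (1 + q)"
    by metis
  then show ?thesis
    by (simp add: exp_gen_euler_operator[OF c] F_def F'_def)
qed

section \<open>Fox-Wright coefficients\<close>

definition Fox_Wright_coeff :: "real \<Rightarrow> real \<Rightarrow> real \<Rightarrow> real \<Rightarrow> nat \<Rightarrow> real" where
  "Fox_Wright_coeff \<alpha> \<beta> B b k =
     Gamma b * (Gamma (\<alpha> + real k) / (Gamma (b + real k * B) * Gamma (\<beta> + real k)))"

lemma Gamma_midpoint_log_convex:
  fixes x h :: real
  assumes "x > 0" and "h \<ge> 0"
  shows "Gamma (x + h) ^ 2 \<le> Gamma x * Gamma (x + 2 * h)"
proof -
  have pos: "Gamma x > 0" "Gamma (x + h) > 0" "Gamma (x + 2 * h) > 0"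
    using assms by (auto intro!: Gamma_real_pos)
  have "(ln \<circ> Gamma) ((1 - 1/2) *\<^sub>R x + (1/2) *\<^sub>R (x + 2 * h))
      \<le> (1 - 1/2) * (ln \<circ> Gamma) x + 1/2 * (ln \<circ> Gamma) (x + 2 * h)"
    using assms by (intro convex_onD[OF log_convex_Gamma_real]) auto
  moreover have "(1 - 1/2) *\<^sub>R x + (1/2) *\<^sub>R (x + 2 * h) = x + h"
    by (simp add: field_simps)
  ultimately have "2 * ln (Gamma (x + h)) \<le> ln (Gamma x) + ln (Gamma (x + 2 * h))"
    by simp
  then have "ln (Gamma (x + h) ^ 2) \<le> ln (Gamma x * Gamma (x + 2 * h))"
    using pos by (simp add: ln_mult ln_realpow)
  then show ?thesis
    using pos by (subst (asm) ln_le_cancel_iff) auto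
qed

lemma Fox_Wright_coeff_log_concave:
  assumes "\<alpha> > 0" and "\<beta> > 0" and "B \<ge> 0" and "\<alpha> \<ge> \<beta>" and "b > 0"
  shows "log_concave_seq (Fox_Wright_coeff \<alpha> \<beta> B b)"
  unfolding log_concave_seq_def
proof (intro allI conjI)
  fix k :: nat
  define a where "a = \<alpha> + real k"
  define d where "d = \<beta> + real k"
  define x where "x = b + real k * B"
  have pos: "a > 0" "d > 0" "x > 0" "a \<ge> d"
    using assms by (auto simp: a_def d_def x_def add_pos_nonneg)
  have G: "Gamma a > 0" "Gamma d > 0" "Gamma x > 0" "Gamma (x + B) > 0" "Gamma (x + 2 * B) > 0"
    "Gamma b > 0"
    using pos assms by (auto intro!: Gamma_real_pos)
  have Gamma_shift: "Gamma (y + 1) = y * Gamma y" "Gamma (y + 2) = (y + 1) * (y * Gamma y)"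
    if "y > 0" for y :: real
    using that Gamma_plus1[of y] Gamma_plus1[of "y + 1"]
    by (auto simp: nonpos_Ints_def add.assoc)
  have c0: "Fox_Wright_coeff \<alpha> \<beta> B b k = Gamma b * (Gamma a / (Gamma x * Gamma d))"
    by (simp add: Fox_Wright_coeff_def a_def d_def x_def)
  have "\<alpha> + real (Suc k) = a + 1" "\<beta> + real (Suc k) = d + 1" "b + real (Suc k) * B = x + B"
    by (auto simp: a_def d_def x_def algebra_simps)
  then have c1: "Fox_Wright_coeff \<alpha> \<beta> B b (Suc k)
      = Gamma b * (a * Gamma a / (Gamma (x + B) * (d * Gamma d)))"
    using pos unfolding Fox_Wright_coeff_def by (simp only: Gamma_shift)
  have "\<alpha> + real (Suc (Suc k)) = a + 2" "\<beta> + real (Suc (Suc k)) = d + 2"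
    "b + real (Suc (Suc k)) * B = x + 2 * B"
    by (auto simp: a_def d_def x_def algebra_simps)
  then have c2: "Fox_Wright_coeff \<alpha> \<beta> B b (Suc (Suc k))
      = Gamma b * ((a + 1) * (a * Gamma a) / (Gamma (x + 2 * B) * ((d + 1) * (d * Gamma d))))"
    using pos unfolding Fox_Wright_coeff_def by (simp only: Gamma_shift)
  show "Fox_Wright_coeff \<alpha> \<beta> B b k > 0"
    unfolding c0 using G by simp
  \<comment> \<open>The two sides are \<open>c\<^sub>k\<^sub>+\<^sub>2 c\<^sub>k\<close> and \<open>c\<^sub>k\<^sub>+\<^sub>1\<^sup>2\<close> without their common factor, called \<open>?K\<close> below.\<close>
  have "(a + 1) / (d + 1) * (1 / (Gamma x * Gamma (x + 2 * B))) \<le> a / d * (1 / Gamma (x + B) ^ 2)"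
  proof (rule mult_mono)
    show "(a + 1) / (d + 1) \<le> a / d"
      using pos by (simp add: divide_simps algebra_simps)
    show "1 / (Gamma x * Gamma (x + 2 * B)) \<le> 1 / Gamma (x + B) ^ 2"
      using Gamma_midpoint_log_convex[OF pos(3) assms(3)] G by (intro divide_left_mono) auto
  qed (use pos G in auto)
  then have "Gamma b ^ 2 * (a / d) * (Gamma a / Gamma d) ^ 2 *
        ((a + 1) / (d + 1) * (1 / (Gamma x * Gamma (x + 2 * B))))
      \<le> Gamma b ^ 2 * (a / d) * (Gamma a / Gamma d) ^ 2 * (a / d * (1 / Gamma (x + B) ^ 2))"
    (is "?K * _ \<le> _")
    using pos by (intro mult_left_mono) auto
  moreover have "Fox_Wright_coeff \<alpha> \<beta> B b (Suc (Suc k)) * Fox_Wright_coeff \<alpha> \<beta> B b k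
      = ?K * ((a + 1) / (d + 1) * (1 / (Gamma x * Gamma (x + 2 * B))))"
    unfolding c0 c2 using pos G by (simp add: power2_eq_square mult_ac)
  moreover have "Fox_Wright_coeff \<alpha> \<beta> B b (Suc k) ^ 2
      = ?K * (a / d * (1 / Gamma (x + B) ^ 2))"
    unfolding c1 using pos G by (simp add: power2_eq_square mult_ac)
  ultimately show "Fox_Wright_coeff \<alpha> \<beta> B b (Suc (Suc k)) * Fox_Wright_coeff \<alpha> \<beta> B b k
      \<le> Fox_Wright_coeff \<alpha> \<beta> B b (Suc k) ^ 2"
    by simp
qed

lemma Fox_Wright_coeff_plus1:
  assumes "b > 0" and "B \<ge> 0"
  shows "Fox_Wright_coeff \<alpha> \<beta> B b k
       = (1 + B / b * real k) * Fox_Wright_coeff \<alpha> \<beta> B (b + 1) k"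
proof -
  define x where "x = b + real k * B"
  have x: "x > 0"
    using assms by (auto simp: x_def add_pos_nonneg)
  have Gx: "Gamma (b + 1 + real k * B) = x * Gamma x"
    using x Gamma_plus1[of x] by (auto simp: nonpos_Ints_def x_def add_ac)
  have Gb: "Gamma (b + 1) = b * Gamma b"
    using assms Gamma_plus1[of b] by (auto simp: nonpos_Ints_def)
  have "1 + B / b * real k = x / b"
    using assms by (simp add: x_def field_simps)
  then show ?thesis
    unfolding Fox_Wright_coeff_def Gx Gb x_def[symmetric] using x assms by simp
qed

lemma Psi_tilde_eq_exp_gen:
  assumes "log_concave_seq (Fox_Wright_coeff \<alpha> \<beta> B b)" and "b > 0"
  shows "Psi_tilde \<alpha> \<beta> B b z = exp_gen (Fox_Wright_coeff \<alpha> \<beta> B b) z"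
proof -
  have G: "Gamma b > 0"
    using assms by (intro Gamma_real_pos) auto
  let ?g = "\<lambda>k. Gamma (\<alpha> + real k) / (Gamma (b + real k * B) * Gamma (\<beta> + real k))
                * (z ^ k / fact k)"
  have "summable (\<lambda>k. Gamma b * ?g k)"
    using summable_exp_gen[OF assms(1), of z] by (simp add: Fox_Wright_coeff_def mult.assoc)
  then have "summable ?g"
    using G by (subst (asm) summable_cmult_iff) auto
  then have "(\<Sum>k. Gamma b * ?g k) = Gamma b * (\<Sum>k. ?g k)"
    by (rule suminf_mult)
  then show ?thesis
    by (simp add: Psi_tilde_eq exp_gen_def Fox_Wright_coeff_def mult.assoc)
qed

section \<open>The inequality between contiguous Fox-Wright functions\<close>

theorem theorem7:
  fixes \<alpha>\<^sub>1 \<beta>\<^sub>1 \<beta>\<^sub>2 B\<^sub>1 z :: real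
  assumes "\<alpha>\<^sub>1 > 0" and "\<beta>\<^sub>1 > 0" and "\<beta>\<^sub>2 > 0" and "B\<^sub>1 \<ge> 0"
    and "\<alpha>\<^sub>1 \<ge> \<beta>\<^sub>2"
    and "z \<in> {0<..}"
  shows "((Gamma \<alpha>\<^sub>1 / Gamma \<beta>\<^sub>2) powr (B\<^sub>1 / \<beta>\<^sub>1) * Psi_tilde \<alpha>\<^sub>1 \<beta>\<^sub>2 B\<^sub>1 \<beta>\<^sub>1 z)
           powr (Gamma (\<beta>\<^sub>1 + B\<^sub>1) / Gamma \<beta>\<^sub>1)
         \<le> Psi_tilde \<alpha>\<^sub>1 \<beta>\<^sub>2 B\<^sub>1 (\<beta>\<^sub>1 + 1) z
           powr (Gamma (\<beta>\<^sub>1 + B\<^sub>1 + 1) / Gamma (\<beta>\<^sub>1 + 1))"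
proof -
  define q where "q = B\<^sub>1 / \<beta>\<^sub>1"
  define g where "g = Gamma (\<beta>\<^sub>1 + B\<^sub>1) / Gamma \<beta>\<^sub>1"
  define c where "c = Fox_Wright_coeff \<alpha>\<^sub>1 \<beta>\<^sub>2 B\<^sub>1 (\<beta>\<^sub>1 + 1)"
  have q: "q \<ge> 0" and z: "z > 0"
    using assms by (auto simp: q_def)
  have G: "Gamma \<beta>\<^sub>1 > 0" "Gamma (\<beta>\<^sub>1 + 1) > 0" "Gamma (\<beta>\<^sub>1 + B\<^sub>1) > 0"
    using assms by (auto intro!: Gamma_real_pos)
  have g: "g > 0"
    using G by (simp add: g_def)
  have c: "log_concave_seq c" and c': "log_concave_seq (Fox_Wright_coeff \<alpha>\<^sub>1 \<beta>\<^sub>2 B\<^sub>1 \<beta>\<^sub>1)"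
    using assms by (auto simp: c_def intro!: Fox_Wright_coeff_log_concave)
  have c0: "c 0 = Gamma \<alpha>\<^sub>1 / Gamma \<beta>\<^sub>2"
    using G by (simp add: c_def Fox_Wright_coeff_def)
  have "Fox_Wright_coeff \<alpha>\<^sub>1 \<beta>\<^sub>2 B\<^sub>1 \<beta>\<^sub>1 = (\<lambda>k. (1 + q * real k) * c k)"
    unfolding q_def c_def using assms by (intro ext Fox_Wright_coeff_plus1) auto
  then have Psi: "Psi_tilde \<alpha>\<^sub>1 \<beta>\<^sub>2 B\<^sub>1 \<beta>\<^sub>1 z = exp_gen (\<lambda>k. (1 + q * real k) * c k) z"
    using Psi_tilde_eq_exp_gen[OF c'] assms by simp
  have Psi1: "Psi_tilde \<alpha>\<^sub>1 \<beta>\<^sub>2 B\<^sub>1 (\<beta>\<^sub>1 + 1) z = exp_gen c z"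
    using Psi_tilde_eq_exp_gen[OF c[unfolded c_def]] assms by (simp add: c_def)
  have "Gamma (\<beta>\<^sub>1 + B\<^sub>1 + 1) / Gamma (\<beta>\<^sub>1 + 1) = (\<beta>\<^sub>1 + B\<^sub>1) * Gamma (\<beta>\<^sub>1 + B\<^sub>1) / (\<beta>\<^sub>1 * Gamma \<beta>\<^sub>1)"
    using assms Gamma_plus1[of \<beta>\<^sub>1] Gamma_plus1[of "\<beta>\<^sub>1 + B\<^sub>1"] by (auto simp: nonpos_Ints_def)
  also have "\<dots> = (1 + q) * g"
    using assms G by (simp add: q_def g_def field_simps)
  finally have expo: "Gamma (\<beta>\<^sub>1 + B\<^sub>1 + 1) / Gamma (\<beta>\<^sub>1 + 1) = (1 + q) * g" .
  have "exp_gen (\<lambda>k. (1 + q * real k) * c k) z \<ge> 0"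
    using exp_gen_pos[OF c', of z] z Psi Psi_tilde_eq_exp_gen[OF c', of z] assms by simp
  then have "(c 0 powr q * exp_gen (\<lambda>k. (1 + q * real k) * c k) z) powr g
      \<le> (exp_gen c z powr (1 + q)) powr g"
    using exp_gen_euler_operator_le_powr[OF c q z] g by (intro powr_mono2) auto
  then show ?thesis
    unfolding Psi Psi1 expo c0[symmetric] q_def[symmetric] g_def[symmetric] by (simp add: powr_powr)
qed

end
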